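(* Assume that $\mathbf{R}:\mathbb{R}^N\to\mathbb{R}^m$ is continuously differentiable and that its Jacobian $\mathbf{J}$ is $L$-Lipschitz continuous on $\mathbb{R}^N$, i.e. $\|\mathbf{J}(\mathbf{x})-\mathbf{J}(\mathbf{y})\|\le L\|\mathbf{x}-\mathbf{y}\|$ for all $\mathbf{x},\mathbf{y}\in\mathbb{R}^N$. Let $\{\mathbf{x}^k\}$ be a sequence generated by the LMS algorithm (described in the context) with arbitrary $\mathbf{x}^0\in\mathbb{R}^N$. If $\{\mathbf{x}^k\}$ is bounded, then it has at least one accumulation point that is also a stationary point of $\mathbf{F}$, i.e. a point $\bar{\mathbf{x}}$ with $\mathbf{J}(\bar{\mathbf{x}})^\top\mathbf{R}(\bar{\mathbf{x}})=0$.
   Context: Norms are Euclidean (spectral for matrices). $\mathbf{R}:\mathbb{R}^N\to\mathbb{R}^m$ is the residual vector, $\mathbf{J}(\mathbf{x})\in\mathbb{R}^{m\times N}$ its Jacobian, $\mathbf{F}(\mathbf{x})=\frac12\|\mathbf{R}(\mathbf{x})\|^2$, and $\mathbf{g}(\mathbf{x})=\mathbf{J}(\mathbf{x})^\top\mathbf{R}(\mathbf{x})$ is the gradient of $\mathbf{F}$. A partition $I_1,\dots,I_K$ of the variable indices $\{1,\dots,N\}$ is fixed. $\mathbf{H}(\mathbf{x})$ is the block diagonal part of $\mathbf{J}(\mathbf{x})^\top\mathbf{J}(\mathbf{x})$ with respect to this partition (entries $(i,j)$ with $i,j$ in the same $I_s$ are kept, all others are set to zero), and $\mathbf{B}(\mathbf{x})=\mathbf{J}(\mathbf{x})^\top\mathbf{J}(\mathbf{x})-\mathbf{H}(\mathbf{x})$.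 A subscript or superscript $k$ denotes evaluation at $\mathbf{x}^k$: $\mathbf{R}_k,\mathbf{J}_k,\mathbf{H}_k,\mathbf{B}_k,\mathbf{g}^k$. LMS algorithm. Parameters: $c\in(0,1)$, $b\in(0,1)$, $\eta\in[0,1)$, $0\le\ell_{\min}<\ell_0$; starting point $\mathbf{x}^0$. Iteration $k\ge 0$: 1. Set $\mu_k=1+\frac{(1+b)^2}{1-b}\max_{i=0,1,2,3}\hat a_i^k$, where $\hat a_0^k=\frac{\ell_k^2}{4}\|\mathbf{H}_k\|\|\mathbf{J}_k\|\|\mathbf{R}_k\|$, $\hat a_1^k=\frac{\ell_k^2}{4}\|\mathbf{J}_k\|\|\mathbf{R}_k\|+\ell_k\|\mathbf{H}_k\|\|\mathbf{J}_k\|^2\|\mathbf{R}_k\|$, $\hat a_2^k=\|\mathbf{H}_k\|\|\mathbf{J}_k\|^2+\ell_k\|\mathbf{H}_k\|\|\mathbf{R}_k\|+\ell_k\|\mathbf{J}_k\|^2\|\mathbf{R}_k\|$, $\hat a_3^k=\|\mathbf{J}_k\|^2+\ell_k\|\mathbf{R}_k\|$. 2. Choose any $\beta_k\in\mathbb{R}$ with $\|\beta_k\mathbf{B}_k\|\le\frac{b\mu_k}{\|\mathbf{H}_k\|+\mu_k}$. 3. Set $\gamma_k=\|\mathbf{I}-\beta_k\mathbf{B}_k\|$. 4. Let $\mathbf{d}^k$ solve $(\mathbf{H}_k+\mu_k\mathbf{I})\mathbf{d}^k=(\beta_k\mathbf{B}_k-\mathbf{I})\mathbf{g}^k$. 5.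 Let $t_k$ be the largest positive $t\le\min\{1,1/\gamma_k\}$ such that $\mathbf{F}(\mathbf{x}^k+t\mathbf{d}^k)\le\mathbf{F}(\mathbf{x}^k)+ct(\mathbf{d}^k)^\top\mathbf{g}^k$. 6. Set $\mathbf{x}^{k+1}=\mathbf{x}^k+t_k\mathbf{d}^k$. 7. If $t_k<\min\{1,1/\gamma_k\}$, set $\ell_{k+1}=2\ell_k$. Otherwise let $A_k=\mathbf{F}(\mathbf{x}^{k+1})-\mathbf{F}(\mathbf{x}^k)$ and $P_k=\mathbf{F}(\mathbf{x}^k)-\|\mathbf{R}_k+\mathbf{J}_k\mathbf{d}^k\|^2-\mu_k\|\mathbf{d}^k\|^2$; set $\ell_{k+1}=\max\{\ell_{\min},\ell_k/2\}$ if $A_k>\eta P_k$, and $\ell_{k+1}=\ell_k$ otherwise. *)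

theory Defs
  imports "HOL-Analysis.Analysis"
begin

text \<open>The type-class norm on \<^typ>\<open>real ^ 'n ^ 'm\<close> is the Frobenius norm, hence a separate
  constant for the spectral norm.\<close>

definition spectral_norm :: "real ^ 'n ^ 'm \<Rightarrow> real"
  where "spectral_norm A = onorm (\<lambda>v. A *v v)"

definition jac :: "(real ^ 'n \<Rightarrow> real ^ 'm) \<Rightarrow> real ^ 'n \<Rightarrow> real ^ 'n ^ 'm"
  where "jac R x = jacobian R (at x)"

definition objective :: "(real ^ 'n \<Rightarrow> real ^ 'm) \<Rightarrow> real ^ 'n \<Rightarrow> real"
  where "objective R x = (1/2) * (norm (R x))\<^sup>2"

definition grad :: "(real ^ 'n \<Rightarrow> real ^ 'm) \<Rightarrow> real ^ 'n \<Rightarrow> real ^ 'n"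
  where "grad R x = transpose (jac R x) *v R x"

definition block_diag :: "'n set set \<Rightarrow> real ^ 'n ^ 'n \<Rightarrow> real ^ 'n ^ 'n"
  where "block_diag P A = (\<chi> i j. if \<exists>S\<in>P. i \<in> S \<and> j \<in> S then A $ i $ j else 0)"

definition Hmat :: "'n set set \<Rightarrow> (real ^ 'n \<Rightarrow> real ^ 'm) \<Rightarrow> real ^ 'n \<Rightarrow> real ^ 'n ^ 'n"
  where "Hmat P R x = block_diag P (transpose (jac R x) ** jac R x)"

definition Bmat :: "'n set set \<Rightarrow> (real ^ 'n \<Rightarrow> real ^ 'm) \<Rightarrow> real ^ 'n \<Rightarrow> real ^ 'n ^ 'n"
  where "Bmat P R x = transpose (jac R x) ** jac R x - Hmat P R x"

definition lms_mu ::
    "'n set set \<Rightarrow> (real ^ 'n \<Rightarrow> real ^ 'm) \<Rightarrow> real \<Rightarrow> real ^ 'n \<Rightarrow> real \<Rightarrow> real"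
  where "lms_mu P R b x l =
    (let h = spectral_norm (Hmat P R x);
         j = spectral_norm (jac R x);
         r = norm (R x);
         a0 = l\<^sup>2 / 4 * h * j * r;
         a1 = l\<^sup>2 / 4 * j * r + l * h * j\<^sup>2 * r;
         a2 = h * j\<^sup>2 + l * h * r + l * j\<^sup>2 * r;
         a3 = j\<^sup>2 + l * r
     in 1 + (1 + b)\<^sup>2 / (1 - b) * Max {a0, a1, a2, a3})"

definition lms_gamma ::
    "'n set set \<Rightarrow> (real ^ 'n \<Rightarrow> real ^ 'm) \<Rightarrow> real ^ 'n \<Rightarrow> real \<Rightarrow> real"
  where "lms_gamma P R x \<beta> = spectral_norm (mat 1 - \<beta> *\<^sub>R Bmat P R x)"

definition armijo ::
    "(real ^ 'n \<Rightarrow> real ^ 'm) \<Rightarrow> real \<Rightarrow> real ^ 'n \<Rightarrow> real ^ 'n \<Rightarrow> real \<Rightarrow> bool"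
  where "armijo R c x d t \<longleftrightarrow>
    objective R (x + t *\<^sub>R d) \<le> objective R x + c * t * (d \<bullet> grad R x)"

definition next_ell ::
    "(real ^ 'n \<Rightarrow> real ^ 'm) \<Rightarrow> real \<Rightarrow> real \<Rightarrow> real \<Rightarrow> real \<Rightarrow> real ^ 'n \<Rightarrow> real ^ 'n
      \<Rightarrow> real \<Rightarrow> real \<Rightarrow> real ^ 'n \<Rightarrow> real"
  where "next_ell R \<eta> l_min \<mu> tmax x d t l x' =
    (let A = objective R x' - objective R x;
         P = objective R x - (norm (R x + jac R x *v d))\<^sup>2 - \<mu> * (norm d)\<^sup>2
     in if t < tmax then 2 * l
        else if A > \<eta> * P then max l_min (l / 2)
        else l)"

text \<open>One iteration from \<open>(x, l)\<close> to \<open>(x', l')\<close> with choices \<open>\<beta>\<close>, \<open>d\<close>, \<open>t\<close>. The bound on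
  \<open>\<beta>\<close> with \<open>0 < b < 1\<close> forces \<open>lms_gamma \<ge> 1 - b > 0\<close>, so \<open>1 / lms_gamma\<close> is a genuine
  quotient.\<close>

definition lms_step ::
    "'n set set \<Rightarrow> (real ^ 'n \<Rightarrow> real ^ 'm) \<Rightarrow> real \<Rightarrow> real \<Rightarrow> real \<Rightarrow> real
      \<Rightarrow> real ^ 'n \<Rightarrow> real \<Rightarrow> real \<Rightarrow> real ^ 'n \<Rightarrow> real \<Rightarrow> real ^ 'n \<Rightarrow> real \<Rightarrow> bool"
  where "lms_step P R c b \<eta> l_min x l \<beta> d t x' l' \<longleftrightarrow>
    (let H = Hmat P R x;
         B = Bmat P R x;
         \<mu> = lms_mu P R b x l;
         tmax = min 1 (1 / lms_gamma P R x \<beta>)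
     in spectral_norm (\<beta> *\<^sub>R B) \<le> b * \<mu> / (spectral_norm H + \<mu>) \<and>
        (H + \<mu> *\<^sub>R mat 1) *v d = (\<beta> *\<^sub>R B - mat 1) *v grad R x \<and>
        0 < t \<and> t \<le> tmax \<and> armijo R c x d t \<and>
        (\<forall>s. 0 < s \<and> s \<le> tmax \<and> armijo R c x d s \<longrightarrow> s \<le> t) \<and>
        x' = x + t *\<^sub>R d \<and>
        l' = next_ell R \<eta> l_min \<mu> tmax x d t l x')"

definition lms_sequence ::
    "'n set set \<Rightarrow> (real ^ 'n \<Rightarrow> real ^ 'm) \<Rightarrow> real \<Rightarrow> real \<Rightarrow> real \<Rightarrow> real \<Rightarrow> real
      \<Rightarrow> (nat \<Rightarrow> real ^ 'n) \<Rightarrow> bool"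
  where "lms_sequence P R c b \<eta> l_min l_0 x \<longleftrightarrow>
    (\<exists>l \<beta> d t. l 0 = l_0 \<and>
      (\<forall>k. lms_step P R c b \<eta> l_min (x k) (l k) (\<beta> k) (d k) (t k) (x (Suc k)) (l (Suc k))))"

text \<open>A point is an accumulation point of a sequence if some subsequence converges to it; it need
  not be a limit point of the range, as the sequence may become constant.\<close>

definition seq_accumulation_point :: "(nat \<Rightarrow> 'a::topological_space) \<Rightarrow> 'a \<Rightarrow> bool"
  where "seq_accumulation_point x p \<longleftrightarrow>
    (\<exists>r. strict_mono (r :: nat \<Rightarrow> nat) \<and> (x \<circ> r) \<longlonglongrightarrow> p)"

end

theory Submission
  imports Defs
begin

text \<open>Suppose no accumulation point is stationary. By boundedness, \<open>norm (grad R (x k)) \<ge> e > 0\<close>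
  eventually, hence also \<open>R (x k)\<close> is bounded away from zero. The descent estimates for \<open>d k\<close> and
  a quadratic upper model of the objective show that the Armijo condition holds for every
  \<open>s \<le> min 1 (\<kappa> * \<mu> k)\<close> with \<open>\<kappa>\<close> independent of \<open>k\<close>. Since \<open>\<mu> k \<ge> 1 + ell k * norm (R (x k))\<close>, a
  large \<open>ell k\<close> makes the maximal step acceptable, so \<open>ell k\<close> is not doubled then. Thus \<open>ell\<close> and
  \<open>\<mu>\<close> stay bounded, \<open>t k\<close> stays bounded away from zero, and the nonnegative objective drops by
  a fixed amount in every iteration, which is absurd.\<close>

section \<open>Spectral norm estimates and the adjoint identity\<close>

lemma norm_matrix_vector_mult_le:
  assumes "spectral_norm A \<le> a"
  shows "norm (A *v v) \<le> a * norm v"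
proof -
  have "norm (A *v v) \<le> spectral_norm A * norm v"
    unfolding spectral_norm_def
    by (rule onorm) (rule matrix_vector_mul_bounded_linear)
  also have "\<dots> \<le> a * norm v"
    using assms by (rule mult_right_mono) simp
  finally show ?thesis .
qed

lemma spectral_norm_nonneg: "0 \<le> spectral_norm A"
  unfolding spectral_norm_def by (rule onorm_pos_le) (rule matrix_vector_mul_bounded_linear)

lemma spectral_norm_leI:
  assumes "\<And>v. norm (A *v v) \<le> B * norm v"
  shows "spectral_norm A \<le> B"
  unfolding spectral_norm_def using assms by (rule onorm_le)

lemma inner_transpose_mult: "(v :: real ^ 'n) \<bullet> (transpose A *v w) = (A *v v) \<bullet> w"
  by (metis dot_lmul_matrix inner_commute transpose_matrix_vector)

section \<open>Positive semidefinite forms and the block diagonal part\<close>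

text \<open>The form of the block diagonal part at \<open>v\<close> is the sum over the blocks of
  the form of \<open>A\<close> at the restriction of \<open>v\<close> to that block.\<close>

lemma block_diag_positive_semidefinite:
  fixes A :: "real ^ 'n ^ 'n"
  assumes P: "partition_on UNIV P" and A: "\<And>v. 0 \<le> v \<bullet> (A *v v)"
  shows "0 \<le> v \<bullet> (block_diag P A *v v)"
proof -
  define rs :: "'n set \<Rightarrow> real ^ 'n" where "rs S = (\<chi> i. if i \<in> S then v $ i else 0)" for S
  \<comment> \<open>Disjointness of the blocks: the only block that contains \<open>i\<close> is
    \<open>S\<close>, so the kept entries of row \<open>i\<close> are those with column in
    \<open>S\<close>.\<close>
  have same: "(\<exists>T\<in>P. i \<in> T \<and> j \<in> T) \<longleftrightarrow> j \<in> S" if "S \<in> P" "i \<in> S" for S i j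
    using that P by (metis partition_onD2 disjointD IntI empty_iff)
  have row: "(block_diag P A *v v) $ i = (A *v rs S) $ i" if "S \<in> P" "i \<in> S" for S i
    unfolding matrix_vector_mult_def block_diag_def rs_def
    by (auto simp: same[OF that] intro!: sum.cong)
  have "v \<bullet> (block_diag P A *v v) = (\<Sum>i\<in>\<Union>P. v $ i * (block_diag P A *v v) $ i)"
    using partition_onD1[OF P] by (simp add: inner_vec_def)
  also have "\<dots> = (\<Sum>S\<in>P. \<Sum>i\<in>S. v $ i * (block_diag P A *v v) $ i)"
    using partition_onD2[OF P] by (subst sum.Union_disjoint) (auto simp: disjoint_def)
  also have "\<dots> = (\<Sum>S\<in>P. rs S \<bullet> (A *v rs S))"
  proof (rule sum.cong[OF refl])
    fix S assume S: "S \<in> P"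
    have "(\<Sum>i\<in>S. v $ i * (block_diag P A *v v) $ i) = (\<Sum>i\<in>S. rs S $ i * (A *v rs S) $ i)"
      by (rule sum.cong) (auto simp: row[OF S] rs_def)
    also have "\<dots> = rs S \<bullet> (A *v rs S)"
      unfolding inner_vec_def by (rule sum.mono_neutral_cong_left) (auto simp: rs_def)
    finally show "(\<Sum>i\<in>S. v $ i * (block_diag P A *v v) $ i) = rs S \<bullet> (A *v rs S)" .
  qed
  also have "\<dots> \<ge> 0" by (intro sum_nonneg A)
  finally show ?thesis .
qed

lemma transpose_block_diag: "transpose (block_diag P A) = block_diag P (transpose A)"
  by (auto simp: block_diag_def transpose_def vec_eq_iff)

lemma Hmat_positive_semidefinite:
  assumes "partition_on UNIV P"
  shows "0 \<le> v \<bullet> (Hmat P R y *v v)"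
  unfolding Hmat_def
  by (rule block_diag_positive_semidefinite[OF assms])
     (simp add: inner_transpose_mult del: transpose_matrix_vector flip: matrix_vector_mul_assoc)

lemma Hmat_symmetric: "transpose (Hmat P R y) = Hmat P R y"
  by (simp add: Hmat_def transpose_block_diag matrix_transpose_mul)

text \<open>Expand the nonnegative quadratic form at \<open>u - A u / a\<close>.\<close>

lemma norm_mult_le_quadratic_form:
  fixes A :: "real ^ 'n ^ 'n"
  assumes sym: "transpose A = A" and psd: "\<And>v. 0 \<le> v \<bullet> (A *v v)"
    and a: "0 < a" "spectral_norm A \<le> a"
  shows "(norm (A *v u))\<^sup>2 \<le> a * (u \<bullet> (A *v u))"
proof -
  define w where "w = A *v u"
  have "w \<bullet> (A *v w) \<le> norm w * norm (A *v w)"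
    by (rule norm_cauchy_schwarz)
  also have "\<dots> \<le> norm w * (a * norm w)"
    by (intro mult_left_mono norm_matrix_vector_mult_le a norm_ge_zero)
  finally have le: "w \<bullet> (A *v w) \<le> a * (norm w)\<^sup>2" by (simp add: power2_eq_square mult_ac)
  have uw: "u \<bullet> (A *v w) = (norm w)\<^sup>2"
    using inner_transpose_mult[of u A w] sym by (simp add: w_def dot_square_norm)
  have "0 \<le> (a *\<^sub>R u - w) \<bullet> (A *v (a *\<^sub>R u - w))" by (rule psd)
  also have "A *v (a *\<^sub>R u - w) = a *\<^sub>R w - A *v w"
    by (simp add: matrix_vector_mult_diff_distrib w_def matrix_vector_mult_scaleR)
  also have "(a *\<^sub>R u - w) \<bullet> (a *\<^sub>R w - A *v w) = a\<^sup>2 * (u \<bullet> w) - 2 * a * (norm w)\<^sup>2 + w \<bullet> (A *v w)"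
    by (simp add: inner_diff_left inner_diff_right uw dot_square_norm power2_eq_square algebra_simps)
  finally have "0 \<le> a\<^sup>2 * (u \<bullet> w) - a * (norm w)\<^sup>2" using le by simp
  then have "0 \<le> a * (a * (u \<bullet> w) - (norm w)\<^sup>2)" by (simp add: power2_eq_square algebra_simps)
  then show ?thesis using a(1) by (simp add: zero_le_mult_iff w_def)
qed

section \<open>The shifted system and the search direction\<close>

text \<open>Pair the equation with \<open>d\<close>, discard the nonnegative term of
  \<open>H\<close>, and apply Cauchy-Schwarz.\<close>

lemma shifted_system_solution_bound:
  fixes H :: "real ^ 'n ^ 'n"
  assumes psd: "\<And>v. 0 \<le> v \<bullet> (H *v v)" and mu: "0 < \<mu>"
    and eq: "(H + \<mu> *\<^sub>R mat 1) *v d = w"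
  shows "norm d \<le> norm w / \<mu>"
proof (cases "d = 0")
  case True
  then show ?thesis using mu by simp
next
  case False
  have "\<mu> * (norm d)\<^sup>2 \<le> d \<bullet> w"
    using psd[of d] unfolding eq[symmetric]
    by (simp add: matrix_vector_mult_add_rdistrib scaleR_matrix_vector_assoc[symmetric]
        inner_add_right dot_square_norm)
  also have "\<dots> \<le> norm d * norm w" by (rule norm_cauchy_schwarz)
  finally have "\<mu> * norm d \<le> norm w" using False by (simp add: power2_eq_square)
  then show ?thesis using mu by (simp add: field_simps)
qed

text \<open>The preceding bound with right-hand side 0 gives injectivity, which in finite dimension
  gives surjectivity. This supplies the Levenberg-Marquardt part of the direction.\<close>

lemma shifted_system_solvable:
  fixes H :: "real ^ 'n ^ 'n"
  assumes psd: "\<And>v. 0 \<le> v \<bullet> (H *v v)" and mu: "0 < \<mu>"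
  obtains u where "(H + \<mu> *\<^sub>R mat 1) *v u = w"
proof -
  have "inj ((*v) (H + \<mu> *\<^sub>R mat 1))"
    using shifted_system_solution_bound[OF psd mu, of _ 0]
    by (subst linear_injective_0) (auto intro!: matrix_vector_mul_linear)
  then have "surj ((*v) (H + \<mu> *\<^sub>R mat 1))"
    by (intro linear_injective_imp_surjective matrix_vector_mul_linear) auto
  then show thesis using that by (metis surjD)
qed

text \<open>The direction splits as \<open>d = v - u\<close>, where \<open>u\<close> is the pure Levenberg-Marquardt part and
  \<open>v\<close> is the perturbation caused by the off-diagonal blocks.\<close>

lemma lms_direction_bounds:
  fixes H C :: "real ^ 'n ^ 'n"
  assumes sym: "transpose H = H" and psd: "\<And>v. 0 \<le> v \<bullet> (H *v v)" and mu: "0 < \<mu>"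
    and b: "0 \<le> b"
    and C: "spectral_norm C \<le> b * \<mu> / (spectral_norm H + \<mu>)"
    and eq: "(H + \<mu> *\<^sub>R mat 1) *v d = (C - mat 1) *v g"
  shows "norm d \<le> (1 + b) * norm g / \<mu>"
    and "d \<bullet> g \<le> - (1 - b) * (norm g)\<^sup>2 / (spectral_norm H + \<mu>)"
proof -
  let ?A = "H + \<mu> *\<^sub>R mat 1"
  define h where "h = spectral_norm H"
  have h: "0 \<le> h" by (simp add: h_def spectral_norm_nonneg)
  have hmu: "0 < h + \<mu>" using h mu by simp
  have Cg: "norm (C *v g) \<le> b * \<mu> / (h + \<mu>) * norm g"
    unfolding h_def by (rule norm_matrix_vector_mult_le[OF C])
  have "b * \<mu> / (h + \<mu>) \<le> b" using h mu b by (simp add: divide_le_eq distrib_left)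
  then have Cg': "norm (C *v g) \<le> b * norm g"
    using Cg by (meson order_trans mult_right_mono norm_ge_zero)
  have rhs: "(C - mat 1) *v g = C *v g - g" by (simp add: matrix_vector_mult_diff_rdistrib)
  have "norm ((C - mat 1) *v g) \<le> (1 + b) * norm g"
    using norm_triangle_ineq4[of "C *v g" g] Cg' by (simp add: rhs distrib_right)
  then show "norm d \<le> (1 + b) * norm g / \<mu>"
    using shifted_system_solution_bound[OF psd mu eq] mu
    by (meson order_trans divide_right_mono less_imp_le)
  obtain u where u: "?A *v u = g" by (rule shifted_system_solvable[OF psd mu])
  define v where "v = d + u"
  have v: "?A *v v = C *v g" by (simp add: v_def matrix_vector_right_distrib eq rhs u)
  have Apsd: "0 \<le> z \<bullet> (?A *v z)" for z
    using psd[of z] mu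
    by (simp add: matrix_vector_mult_add_rdistrib scaleR_matrix_vector_assoc[symmetric] inner_add_right)
  have Asym: "transpose ?A = ?A"
    using sym by (auto simp: transpose_def vec_eq_iff mat_def)
  have "spectral_norm ?A \<le> h + \<mu>"
  proof (rule spectral_norm_leI)
    fix z
    have "norm (?A *v z) \<le> norm (H *v z) + norm (\<mu> *\<^sub>R z)"
      by (simp add: matrix_vector_mult_add_rdistrib scaleR_matrix_vector_assoc[symmetric]
          norm_triangle_ineq del: norm_scaleR)
    also have "\<dots> \<le> (h + \<mu>) * norm z"
      using norm_matrix_vector_mult_le[of H _ z, OF order_refl] mu by (simp add: h_def distrib_right)
    finally show "norm (?A *v z) \<le> (h + \<mu>) * norm z" .
  qed
  \<comment> \<open>Applied to the shifted matrix at \<open>u\<close>, whose image is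
    \<open>g\<close>, the inequality turns into a lower bound for
    \<open>u \<bullet> g\<close>.\<close>
  from norm_mult_le_quadratic_form[OF Asym Apsd hmu this, of u]
  have ug: "(norm g)\<^sup>2 / (h + \<mu>) \<le> u \<bullet> g" using hmu by (simp add: u divide_le_eq mult.commute)
  have "v \<bullet> g \<le> norm v * norm g" by (rule norm_cauchy_schwarz)
  also have "norm v \<le> norm (C *v g) / \<mu>" by (rule shifted_system_solution_bound[OF psd mu v])
  \<comment> \<open>The factor \<mu> in the bound on \<open>C\<close> cancels the division by \<mu>.
    What remains has the denominator of \<open>ug\<close>, so the perturbation costs only the
    fraction \<open>b\<close> of the descent.\<close>
  also have "\<dots> \<le> b * \<mu> / (h + \<mu>) * norm g / \<mu>" using Cg mu by (intro divide_right_mono) auto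
  also have "\<dots> = b * norm g / (h + \<mu>)" using mu by simp
  finally have vg: "v \<bullet> g \<le> b * (norm g)\<^sup>2 / (h + \<mu>)"
    by (simp add: power2_eq_square mult_right_mono)
  have "d \<bullet> g = v \<bullet> g - u \<bullet> g" by (simp add: v_def inner_add_left)
  also have "\<dots> \<le> b * (norm g)\<^sup>2 / (h + \<mu>) - (norm g)\<^sup>2 / (h + \<mu>)" using ug vg by simp
  also have "\<dots> = - (1 - b) * (norm g)\<^sup>2 / (spectral_norm H + \<mu>)"
    by (simp add: h_def algebra_simps flip: diff_divide_distrib)
  finally show "d \<bullet> g \<le> - (1 - b) * (norm g)\<^sup>2 / (spectral_norm H + \<mu>)" .
qed

section \<open>Quadratic model of the objective and the Armijo condition\<close>

text \<open>Mean value inequality for \<open>R\<close> minus its linear part at \<open>y\<close>, on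
  the ball of radius \<open>norm s\<close> around \<open>y\<close>. The integral form of the
  remainder would give \<open>L / 2\<close>; the cruder constant suffices.\<close>

lemma jacobian_linearization_error:
  fixes R :: "real ^ 'n \<Rightarrow> real ^ 'm"
  assumes diff: "\<And>y. R differentiable (at y)"
    and lip: "\<And>y z. spectral_norm (jac R y - jac R z) \<le> L * norm (y - z)" and L: "0 \<le> L"
  shows "norm (R (y + s) - R y - jac R y *v s) \<le> L * (norm s)\<^sup>2"
proof -
  define f where "f z = R z - jac R y *v z" for z
  have der: "(f has_derivative (\<lambda>v. (jac R z - jac R y) *v v)) (at z within cball y (norm s))" for z
  proof -
    have "(R has_derivative (*v) (jac R z)) (at z)"
      using jacobian_works[of R "at z"] diff[of z] by (simp add: jac_def)
    moreover have "((*v) (jac R y) has_derivative (*v) (jac R y)) (at z)"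
      by (rule bounded_linear_imp_has_derivative) (rule matrix_vector_mul_bounded_linear)
    ultimately show ?thesis
      unfolding f_def matrix_vector_mult_diff_rdistrib
      by (rule has_derivative_at_withinI[OF has_derivative_diff])
  qed
  have on: "onorm (\<lambda>v. (jac R z - jac R y) *v v) \<le> L * norm s" if "z \<in> cball y (norm s)" for z
    using lip[of z y] that L unfolding spectral_norm_def[symmetric]
    by (auto simp: dist_norm norm_minus_commute intro: order_trans mult_left_mono)
  have "norm (f (y + s) - f y) \<le> L * norm s * norm (y + s - y)"
    by (rule differentiable_bound[OF convex_cball der on]) (auto simp: dist_norm)
  then show ?thesis
    by (simp add: f_def matrix_vector_right_distrib power2_eq_square algebra_simps)
qed

text \<open>Split the increment of \<open>R\<close> into its linear part \<open>q\<close> and the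
  error \<open>e\<close>, and expand the square. The cross term of \<open>R y\<close> with
  \<open>e\<close> yields \<open>L * r\<close>, the square of \<open>q + e\<close> yields the other
  coefficient.\<close>

lemma objective_quadratic_upper_bound:
  fixes R :: "real ^ 'n \<Rightarrow> real ^ 'm"
  assumes diff: "\<And>y. R differentiable (at y)"
    and lip: "\<And>y z. spectral_norm (jac R y - jac R z) \<le> L * norm (y - z)" and L: "0 \<le> L"
    and j: "spectral_norm (jac R y) \<le> j" and r: "norm (R y) \<le> r" and D: "norm s \<le> D"
  shows "objective R (y + s) \<le>
    objective R y + s \<bullet> grad R y + ((j + L * D)\<^sup>2 / 2 + L * r) * (norm s)\<^sup>2"
proof -
  define q where "q = jac R y *v s"
  define e where "e = R (y + s) - R y - q"
  have e: "norm e \<le> L * (norm s)\<^sup>2"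
    unfolding e_def q_def by (rule jacobian_linearization_error[OF diff lip L])
  have q: "norm q \<le> j * norm s"
    unfolding q_def by (rule norm_matrix_vector_mult_le[OF j])
  \<comment> \<open>Trading one factor \<open>norm s\<close> for \<open>D\<close> makes the error
    linear in \<open>norm s\<close>, so that no quartic term appears after squaring.\<close>
  have "L * (norm s)\<^sup>2 \<le> L * D * norm s"
    using mult_right_mono[OF mult_left_mono[OF D L], of "norm s"]
    by (simp add: power2_eq_square mult.assoc)
  with e q have "norm q + norm e \<le> (j + L * D) * norm s" by (simp add: distrib_right)
  then have "norm (q + e) \<le> (j + L * D) * norm s"
    using norm_triangle_ineq order_trans by blast
  then have 1: "(norm (q + e))\<^sup>2 \<le> (j + L * D)\<^sup>2 * (norm s)\<^sup>2"
    by (metis power_mono norm_ge_zero power_mult_distrib)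
  have "R y \<bullet> e \<le> norm (R y) * norm e" by (rule norm_cauchy_schwarz)
  also have "\<dots> \<le> r * (L * (norm s)\<^sup>2)"
    using e r by (intro mult_mono) (auto intro: order_trans[OF norm_ge_zero])
  finally have 2: "R y \<bullet> e \<le> L * r * (norm s)\<^sup>2" by (simp add: mult_ac)
  have "R (y + s) = R y + (q + e)" by (simp add: e_def)
  then have "objective R (y + s) = objective R y + R y \<bullet> (q + e) + (norm (q + e))\<^sup>2 / 2"
    unfolding objective_def
    by (simp only: dot_square_norm[symmetric] inner_add_left inner_add_right)
       (simp add: inner_commute field_simps)
  moreover have "R y \<bullet> q = s \<bullet> grad R y"
    by (simp add: grad_def inner_transpose_mult q_def inner_commute del: transpose_matrix_vector)
  ultimately show ?thesis using 1 2 by (simp add: inner_add_right distrib_right)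
qed

text \<open>Write the squared norm of the left side as an inner product with \<open>w\<close>, then
  cancel one factor.\<close>

lemma norm_transpose_mult_le: "norm (transpose A *v w) \<le> spectral_norm A * norm w"
proof (cases "transpose A *v w = 0")
  case True
  then show ?thesis by (simp add: spectral_norm_nonneg del: transpose_matrix_vector)
next
  case False
  let ?v = "transpose A *v w"
  have "(norm ?v)\<^sup>2 = (A *v ?v) \<bullet> w"
    by (simp only: inner_transpose_mult[symmetric] dot_square_norm)
  also have "\<dots> \<le> norm (A *v ?v) * norm w" by (rule norm_cauchy_schwarz)
  also have "\<dots> \<le> spectral_norm A * norm ?v * norm w"
    by (intro mult_right_mono norm_matrix_vector_mult_le) auto
  finally have "norm ?v * norm ?v \<le> norm ?v * (spectral_norm A * norm w)"
    by (simp only: power2_eq_square mult_ac)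
  then show ?thesis using False
    by (simp del: transpose_matrix_vector)
qed

text \<open>The quadratic remainder must fit into the share \<open>1 - c\<close> of the predicted
  decrease. The remainder scales like \<open>1 / \<mu>\<^sup>2\<close> and the decrease like
  \<open>1 / (h + \<mu>)\<close>, so the admissible step grows in proportion to \<mu>.\<close>

lemma armijo_of_small_step:
  fixes R :: "real ^ 'n \<Rightarrow> real ^ 'm"
  assumes diff: "\<And>y. R differentiable (at y)"
    and lip: "\<And>y z. spectral_norm (jac R y - jac R z) \<le> L * norm (y - z)" and L: "0 \<le> L"
    and j: "spectral_norm (jac R y) \<le> j" and r: "norm (R y) \<le> r" and D: "norm d \<le> D"
    and mu: "1 \<le> \<mu>" and h: "0 \<le> h" "h \<le> hm" and b: "b < 1" and c: "c < 1"
    and dnorm: "norm d \<le> (1 + b) * norm (grad R y) / \<mu>"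
    and descent: "d \<bullet> grad R y \<le> - (1 - b) * (norm (grad R y))\<^sup>2 / (h + \<mu>)"
    and M: "M = (j + L * D)\<^sup>2 / 2 + L * r"
    and s: "0 \<le> s" "s \<le> 1" "s * (M * (1 + b)\<^sup>2 * (hm + 1)) \<le> (1 - c) * (1 - b) * \<mu>"
  shows "armijo R c y d s"
proof -
  define G where "G = (norm (grad R y))\<^sup>2"
  have G: "0 \<le> G" by (simp add: G_def)
  have "0 \<le> r" using r by (rule order_trans[OF norm_ge_zero])
  then have M0: "0 \<le> M" using L by (simp add: M)
  have hmu: "0 < h + \<mu>" using h mu by simp
  \<comment> \<open>Since \<open>1 \<le> \<mu>\<close>, the denominator \<open>h + \<mu>\<close> is
    at most a fixed multiple of \<mu>.\<close>
  have "hm * 1 \<le> hm * \<mu>" using h mu by (intro mult_left_mono) auto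
  then have hm: "h + \<mu> \<le> (hm + 1) * \<mu>" using h by (simp add: distrib_right)
  have "s * (M * (1 + b)\<^sup>2) * (h + \<mu>) \<le> s * (M * (1 + b)\<^sup>2) * ((hm + 1) * \<mu>)"
    using hm s M0 by (intro mult_left_mono) auto
  also have "\<dots> = s * (M * (1 + b)\<^sup>2 * (hm + 1)) * \<mu>" by simp
  also have "\<dots> \<le> (1 - c) * (1 - b) * \<mu> * \<mu>" using s(3) mu by (intro mult_right_mono) auto
  finally have key: "s * M * (1 + b)\<^sup>2 / \<mu>\<^sup>2 \<le> (1 - c) * (1 - b) / (h + \<mu>)"
    using hmu mu by (simp add: field_simps power2_eq_square)
  have "(norm d)\<^sup>2 \<le> ((1 + b) * norm (grad R y) / \<mu>)\<^sup>2"
    using dnorm by (rule power_mono) simp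
  also have "\<dots> = (1 + b)\<^sup>2 / \<mu>\<^sup>2 * G" by (simp add: G_def power_divide power_mult_distrib)
  finally have "s * M * (norm d)\<^sup>2 \<le> s * M * ((1 + b)\<^sup>2 / \<mu>\<^sup>2 * G)"
    using s M0 by (intro mult_left_mono) auto
  also have "\<dots> = s * M * (1 + b)\<^sup>2 / \<mu>\<^sup>2 * G" by simp
  also have "\<dots> \<le> (1 - c) * (1 - b) / (h + \<mu>) * G" using key G by (rule mult_right_mono)
  also have "\<dots> = (1 - c) * - (- (1 - b) * G / (h + \<mu>))"
    by (simp flip: minus_divide_left minus_mult_left del: minus_diff_eq mult_minus_left)
  also have "\<dots> \<le> (1 - c) * - (d \<bullet> grad R y)"
    using descent c by (intro mult_left_mono) (auto simp: G_def)
  finally have main: "s * (s * M * (norm d)\<^sup>2) \<le> s * ((1 - c) * - (d \<bullet> grad R y))"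
    using s(1) by (rule mult_left_mono)
  \<comment> \<open>A scaled step is no longer than \<open>d\<close>, so the coefficient
    \<open>M\<close> built from \<open>D\<close> serves all admissible \<open>s\<close>.\<close>
  have "norm (s *\<^sub>R d) \<le> D"
    using D s mult_right_mono[OF s(2), of "norm d"] by simp
  from objective_quadratic_upper_bound[OF diff lip L j r this]
  have "objective R (y + s *\<^sub>R d) \<le> objective R y + s * (d \<bullet> grad R y) + M * (s\<^sup>2 * (norm d)\<^sup>2)"
    by (simp add: M power_mult_distrib)
  with main show ?thesis by (simp add: armijo_def power2_eq_square algebra_simps)
qed

section \<open>Bounds for the damping parameter and for \<open>ell\<close>\<close>

text \<open>The maximum dominates its entry \<open>a3\<close>, and its prefactor is at least 1. Once
  the residual is bounded away from zero, a large \<open>l\<close> therefore forces a large damping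
  parameter.\<close>

lemma lms_mu_ge:
  assumes "0 \<le> l" "0 \<le> b" "b < 1"
  shows "1 + l * norm (R y) \<le> lms_mu P R b y l"
proof -
  have "1 - b \<le> 1 * 1" using assms by simp
  also have "\<dots> \<le> (1 + b) * (1 + b)" using assms by (intro mult_mono) auto
  finally have 1: "1 \<le> (1 + b)\<^sup>2 / (1 - b)"
    using assms by (simp add: power2_eq_square le_divide_eq)
  have "l * norm (R y) \<le> q * max u (max v (max w (s\<^sup>2 + l * norm (R y))))"
    if "1 \<le> q" for q u v w s :: real
  proof -
    have "l * norm (R y) \<le> max u (max v (max w (s\<^sup>2 + l * norm (R y))))"
      by (simp add: le_max_iff_disj)
    then have "1 * (l * norm (R y)) \<le> q * max u (max v (max w (s\<^sup>2 + l * norm (R y))))"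
      using that assms(1) by (intro mult_mono) auto
    then show ?thesis by simp
  qed
  from this[OF 1] show ?thesis
    by (simp add: lms_mu_def Let_def)
qed

text \<open>Every entry of the maximum is monotone in its nonnegative ingredients, so the witness is
  the same formula evaluated at the upper bounds.\<close>

lemma lms_mu_bounded_above:
  fixes R :: "real ^ 'n \<Rightarrow> real ^ 'm"
  assumes "b < 1"
  obtains m where "\<And>y l. \<lbrakk>0 \<le> l; l \<le> lm; spectral_norm (Hmat P R y) \<le> h;
    spectral_norm (jac R y) \<le> j; norm (R y) \<le> r\<rbrakk> \<Longrightarrow> lms_mu P R b y l \<le> m"
proof -
  have "lms_mu P R b y l \<le> 1 + (1 + b)\<^sup>2 / (1 - b) * Max {lm\<^sup>2 / 4 * h * j * r,
      lm\<^sup>2 / 4 * j * r + lm * h * j\<^sup>2 * r, h * j\<^sup>2 + lm * h * r + lm * j\<^sup>2 * r, j\<^sup>2 + lm * r}"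
    if le: "0 \<le> l" "l \<le> lm" "spectral_norm (Hmat P R y) \<le> h"
      "spectral_norm (jac R y) \<le> j" "norm (R y) \<le> r" for y :: "real ^ 'n" and l
  proof -
    have nonneg: "0 \<le> lm" "0 \<le> h" "0 \<le> j" "0 \<le> r"
      using le spectral_norm_nonneg norm_ge_zero by (blast intro: order_trans)+
    show ?thesis
      unfolding lms_mu_def Let_def
      apply (rule add_left_mono, rule mult_left_mono)
       apply (simp only: Max_insert finite_insert finite.emptyI insert_not_empty not_False_eq_True
          Max_singleton)
       apply (intro max.mono add_mono mult_mono divide_right_mono power_mono)
      using le nonneg assms by (simp_all add: spectral_norm_nonneg)
  qed
  then show thesis by (rule that)
qed

lemma next_ell_pos:
  assumes "0 < l"
  shows "0 < next_ell R \<eta> l_min \<mu> tmax y d t l y'"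
  using assms by (simp add: next_ell_def Let_def less_max_iff_disj)

text \<open>The \<open>max\<close> is there because the halving branch may lift the value up to
  \<open>l_min\<close>: no relation between \<open>l\<close> and \<open>l_min\<close> is assumed
  here.\<close>

lemma next_ell_le_double:
  assumes "0 \<le> l"
  shows "next_ell R \<eta> l_min \<mu> tmax y d t l y' \<le> max l_min (2 * l)"
  using assms by (auto simp: next_ell_def Let_def)

lemma next_ell_le_full_step:
  assumes "0 \<le> l" "\<not> t < tmax"
  shows "next_ell R \<eta> l_min \<mu> tmax y d t l y' \<le> max l_min l"
  using assms by (auto simp: next_ell_def Let_def)

section \<open>Compactness and continuity\<close>

text \<open>Pick a subsequence along which \<open>f\<close> tends to 0, then a convergent
  subsequence of it. With \<open>f\<close> the gradient, the contrapositive gives the lower bound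
  \<open>e\<close> of the main argument.\<close>

lemma accumulation_point_of_vanishing:
  fixes x :: "nat \<Rightarrow> 'a :: heine_borel" and f :: "'a \<Rightarrow> 'b :: real_normed_vector"
  assumes bdd: "bounded (range x)" and cont: "continuous_on UNIV f"
    and small: "\<And>e K. 0 < e \<Longrightarrow> \<exists>k\<ge>K. norm (f (x k)) < e"
  shows "\<exists>p. seq_accumulation_point x p \<and> f p = 0"
proof -
  \<comment> \<open>Searching from \<open>Suc a\<close> on makes the chosen indices strictly
    increasing.\<close>
  have ex: "\<exists>k>a. norm (f (x k)) < 1 / Suc n" for a n
    using small[of "1 / Suc n" "Suc a"] by (auto simp: Suc_le_eq)
  obtain q where q: "\<And>n. norm (f (x (q n))) < 1 / Suc n" "\<And>n. q n < q (Suc n)"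
    using dependent_nat_choice[of "\<lambda>n k. norm (f (x k)) < 1 / Suc n" "\<lambda>n a k. a < k"] ex
    by blast
  have "strict_mono q" using q(2) by (simp add: strict_mono_Suc_iff)
  have "bounded (range (x \<circ> q))" using bdd by (rule bounded_subset) auto
  then obtain p s where s: "strict_mono s" and lim: "((x \<circ> q) \<circ> s) \<longlonglongrightarrow> p"
    using bounded_imp_convergent_subsequence by blast
  have "(\<lambda>n. f (x (q n))) \<longlonglongrightarrow> 0"
    using q(1) LIMSEQ_inverse_real_of_nat
    by (rule_tac Lim_null_comparison[of _ "\<lambda>n. inverse (real (Suc n))"])
       (auto simp: inverse_eq_divide less_imp_le simp del: of_nat_Suc)
  then have "(\<lambda>n. f (x (q (s n)))) \<longlonglongrightarrow> 0"
    using LIMSEQ_subseq_LIMSEQ[OF _ s] by (auto simp: o_def)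
  moreover have "(\<lambda>n. f (x (q (s n)))) \<longlonglongrightarrow> f p"
    using continuous_on_tendsto_compose[OF cont lim] by (simp add: o_def)
  ultimately have "f p = 0" using LIMSEQ_unique by blast
  moreover have "seq_accumulation_point x p"
    unfolding seq_accumulation_point_def
    using lim strict_mono_o[OF \<open>strict_mono q\<close> s] by (metis comp_assoc)
  ultimately show ?thesis by blast
qed

lemma continuous_on_matrix_mult [continuous_intros]:
  fixes A :: "'a :: topological_space \<Rightarrow> real ^ 'n ^ 'm" and B :: "'a \<Rightarrow> real ^ 'k ^ 'n"
  assumes "continuous_on S A" "continuous_on S B"
  shows "continuous_on S (\<lambda>y. A y ** B y)"
  unfolding matrix_matrix_mult_def using assms
  by (intro continuous_intros continuous_on_vec_lambda) auto

lemma continuous_on_transpose [continuous_intros]: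
  fixes A :: "'a :: topological_space \<Rightarrow> real ^ 'n ^ 'm"
  assumes "continuous_on S A"
  shows "continuous_on S (\<lambda>y. transpose (A y))"
  unfolding transpose_def using assms
  by (intro continuous_intros continuous_on_vec_lambda) auto

lemma continuous_on_block_diag [continuous_intros]:
  fixes A :: "'a :: topological_space \<Rightarrow> real ^ 'n ^ 'n"
  assumes "continuous_on S A"
  shows "continuous_on S (\<lambda>y. block_diag P (A y))"
proof -
  have "continuous_on S (\<lambda>y. if Q then A y $ i $ j else 0)" for Q i j
    using assms by (cases Q) (auto intro!: continuous_intros)
  then show ?thesis
    unfolding block_diag_def by (intro continuous_on_vec_lambda)
qed

lemma continuous_on_Hmat:
  assumes "continuous_on UNIV (jac R)"
  shows "continuous_on UNIV (Hmat P R)"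
  unfolding Hmat_def using assms by (intro continuous_intros)

lemma continuous_on_grad:
  fixes R :: "real ^ 'n \<Rightarrow> real ^ 'm"
  assumes J: "continuous_on UNIV (jac R)" and R: "continuous_on UNIV R"
  shows "continuous_on UNIV (grad R)"
proof -
  have "continuous_on UNIV (\<lambda>y. \<chi> i. \<Sum>j\<in>UNIV. transpose (jac R y) $ i $ j * R y $ j)"
    by (intro continuous_intros continuous_on_vec_lambda assms)
  then show ?thesis unfolding grad_def matrix_vector_mult_def .
qed

text \<open>A crude comparison with the Frobenius norm, enough to transfer boundedness.\<close>

lemma spectral_norm_le_norm:
  fixes A :: "real ^ 'n ^ 'm"
  shows "spectral_norm A \<le> real CARD('m) * real CARD('n) * norm A"
  unfolding spectral_norm_def
  by (rule onorm_le_matrix_component)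
     (meson component_le_norm_cart order_trans Finite_Cartesian_Product.norm_nth_le)

text \<open>The closure of \<open>S\<close> is compact. Strict positivity of \<open>B\<close> allows
  division by the bound later.\<close>

lemma spectral_norm_bounded_on_bounded:
  fixes A :: "real ^ 'k \<Rightarrow> real ^ 'n ^ 'm"
  assumes "continuous_on UNIV A" "bounded S"
  obtains B where "0 < B" "\<And>y. y \<in> S \<Longrightarrow> spectral_norm (A y) \<le> B"
proof -
  have "bounded (A ` closure S)"
    using assms by (intro compact_imp_bounded compact_continuous_image)
      (auto intro: continuous_on_subset simp: compact_closure)
  then obtain a where a: "0 < a" "\<And>y. y \<in> S \<Longrightarrow> norm (A y) \<le> a"
    using closure_subset[of S] by (force simp: bounded_pos)
  show thesis
  proof (rule that[of "real CARD('m) * real CARD('n) * a"])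
    show "0 < real CARD('m) * real CARD('n) * a" using a(1) by (simp add: zero_less_card_finite)
    fix y assume "y \<in> S"
    from a(2)[OF this] show "spectral_norm (A y) \<le> real CARD('m) * real CARD('n) * a"
      by (rule order_trans[OF spectral_norm_le_norm mult_left_mono]) simp
  qed
qed

section \<open>Contradiction from a uniform decrease of the objective\<close>

theorem theorem1:
  fixes R :: "real ^ 'n \<Rightarrow> real ^ 'm"
    and P :: "'n set set"
    and c b \<eta> l_min l_0 L :: real
    and x :: "nat \<Rightarrow> real ^ 'n"
  assumes partition: "partition_on UNIV P"
    and c: "0 < c" "c < 1"
    and b: "0 < b" "b < 1"
    and eta: "0 \<le> \<eta>" "\<eta> < 1"
    and l: "0 \<le> l_min" "l_min < l_0"
    and R_diff: "\<forall>y. R differentiable (at y)"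
    and jac_cont: "continuous_on UNIV (jac R)"
    and jac_lipschitz: "\<forall>y z. spectral_norm (jac R y - jac R z) \<le> L * norm (y - z)"
    and run: "lms_sequence P R c b \<eta> l_min l_0 x"
    and bdd: "bounded (range x)"
  shows "\<exists>p. seq_accumulation_point x p \<and> transpose (jac R p) *v R p = 0"
proof (rule ccontr)
  assume contra: "\<not> ?thesis"
  have diff: "\<And>y. R differentiable (at y)" using R_diff by blast
  have L: "0 \<le> L"
  proof -
    \<comment> \<open>The Lipschitz bound at two distinct points, the all-ones vector and the
      origin, fixes the sign of \<open>L\<close>.\<close>
    have "0 \<le> L * norm (1 - 0 :: real ^ 'n)"
      using jac_lipschitz spectral_norm_nonneg order_trans by blast
    moreover have "0 < norm (1 - 0 :: real ^ 'n)" by (simp add: vec_eq_iff)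
    ultimately show ?thesis by (simp add: zero_le_mult_iff)
  qed
  have R_cont: "continuous_on UNIV R"
    using diff by (simp add: continuous_at_imp_continuous_on differentiable_imp_continuous_within)

  obtain j where j: "0 < j" "\<And>k. spectral_norm (jac R (x k)) \<le> j"
    using spectral_norm_bounded_on_bounded[OF jac_cont bdd] by (metis rangeI)
  obtain h where h: "0 < h" "\<And>k. spectral_norm (Hmat P R (x k)) \<le> h"
    using spectral_norm_bounded_on_bounded[OF continuous_on_Hmat[OF jac_cont] bdd] by (metis rangeI)
  have "bounded (R ` closure (range x))"
    using bdd R_cont by (intro compact_imp_bounded compact_continuous_image)
      (auto intro: continuous_on_subset simp: compact_closure)
  then obtain r where r: "0 < r" "\<And>k. norm (R (x k)) \<le> r"
    using closure_subset[of "range x"] by (force simp: bounded_pos)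

  obtain e K where e: "0 < e" "\<And>k. K \<le> k \<Longrightarrow> e \<le> norm (grad R (x k))"
    using accumulation_point_of_vanishing[OF bdd continuous_on_grad[OF jac_cont R_cont]] contra
    by (force simp: grad_def not_less simp del: transpose_matrix_vector)
  have R_ge: "e / j \<le> norm (R (x k))" if "K \<le> k" for k
  proof -
    have "e \<le> spectral_norm (jac R (x k)) * norm (R (x k))"
      using e(2)[OF that] norm_transpose_mult_le unfolding grad_def by (rule order_trans)
    also have "\<dots> \<le> j * norm (R (x k))" using j(2) by (rule mult_right_mono) simp
    finally show ?thesis using j(1) by (simp add: divide_le_eq mult.commute)
  qed

  obtain ell \<beta> d t where
    step: "\<And>k. lms_step P R c b \<eta> l_min (x k) (ell k) (\<beta> k) (d k) (t k) (x (Suc k)) (ell (Suc k))"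
    and ell_0: "ell 0 = l_0"
    using run unfolding lms_sequence_def by blast
  define H where "H k = Hmat P R (x k)" for k
  define \<mu> where "\<mu> k = lms_mu P R b (x k) (ell k)" for k
  define tmax where "tmax k = min 1 (1 / lms_gamma P R (x k) (\<beta> k))" for k
  have C: "spectral_norm (\<beta> k *\<^sub>R Bmat P R (x k)) \<le> b * \<mu> k / (spectral_norm (H k) + \<mu> k)"
    and d_eq: "(H k + \<mu> k *\<^sub>R mat 1) *v d k = (\<beta> k *\<^sub>R Bmat P R (x k) - mat 1) *v grad R (x k)"
    and t: "0 < t k" "t k \<le> tmax k" and t_armijo: "armijo R c (x k) (d k) (t k)"
    and t_max: "\<And>s. \<lbrakk>0 < s; s \<le> tmax k; armijo R c (x k) (d k) s\<rbrakk> \<Longrightarrow> s \<le> t k"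
    and x_Suc: "x (Suc k) = x k + t k *\<^sub>R d k"
    and ell_Suc: "ell (Suc k) =
      next_ell R \<eta> l_min (\<mu> k) (tmax k) (x k) (d k) (t k) (ell k) (x (Suc k))" for k
    using step[of k] by (simp_all add: lms_step_def Let_def H_def \<mu>_def tmax_def)
  have ell_pos: "0 < ell k" for k
    using l by (induction k) (auto simp: ell_0 ell_Suc next_ell_pos)
  have mu_ge: "1 + ell k * norm (R (x k)) \<le> \<mu> k" for k
    unfolding \<mu>_def using ell_pos[of k] b by (intro lms_mu_ge) auto
  have mu_1: "1 \<le> \<mu> k" for k
    using mu_ge[of k] mult_nonneg_nonneg[OF less_imp_le[OF ell_pos[of k]] norm_ge_zero[of "R (x k)"]]
    by linarith
  have mu_pos: "0 < \<mu> k" for k using mu_1[of k] by simp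

  have psd: "0 \<le> v \<bullet> (H k *v v)" for k v
    unfolding H_def by (rule Hmat_positive_semidefinite[OF partition])
  have sym: "transpose (H k) = H k" for k
    unfolding H_def by (rule Hmat_symmetric)
  note direction = lms_direction_bounds[OF sym psd mu_pos less_imp_le[OF b(1)] C d_eq]
  define D where "D = (1 + b) * (j * r)"
  have d_le: "norm (d k) \<le> D" for k
  proof -
    have "norm (grad R (x k)) \<le> j * r"
      unfolding grad_def using j r
      by (intro order_trans[OF norm_transpose_mult_le] mult_mono) (auto intro: less_imp_le)
    then have "(1 + b) * norm (grad R (x k)) / \<mu> k \<le> D / 1"
      unfolding D_def using b mu_1 j r by (intro frac_le mult_left_mono) auto
    with direction(1)[of k] show ?thesis by simp
  qed

  have tmax_ge: "1 / 2 \<le> tmax k" for k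
  proof -
    have "spectral_norm (H k) + \<mu> k > 0"
      using spectral_norm_nonneg[of "H k"] mu_pos[of k] by simp
    then have "b * \<mu> k / (spectral_norm (H k) + \<mu> k) \<le> b"
      using spectral_norm_nonneg[of "H k"] b by (simp add: divide_le_eq distrib_left)
    then have "spectral_norm (\<beta> k *\<^sub>R Bmat P R (x k)) \<le> b" using C[of k] by simp
    then have Bv: "norm (\<beta> k *\<^sub>R Bmat P R (x k) *v v) \<le> b * norm v" for v
      by (rule norm_matrix_vector_mult_le)
    have "lms_gamma P R (x k) (\<beta> k) \<le> 1 + b"
      unfolding lms_gamma_def
    proof (rule spectral_norm_leI)
      fix v
      show "norm ((mat 1 - \<beta> k *\<^sub>R Bmat P R (x k)) *v v) \<le> (1 + b) * norm v"
        using Bv[of v] norm_triangle_ineq4[of v "\<beta> k *\<^sub>R Bmat P R (x k) *v v"]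
        by (simp add: matrix_vector_mult_diff_rdistrib distrib_right)
    qed
    \<comment> \<open>Positivity is read off the run: a positive step not exceeding
      \<open>tmax k\<close> exists, which excludes the default value of \<open>1 / 0\<close>. With
      \<open>lms_gamma\<close> at most \<open>1 + b < 2\<close>, the bound \<open>1 / 2\<close>
      follows.\<close>
    moreover have "0 < 1 / lms_gamma P R (x k) (\<beta> k)"
      using less_le_trans[OF t[of k]] by (simp only: tmax_def min_less_iff_conj)
    then have "0 < lms_gamma P R (x k) (\<beta> k)" by simp
    ultimately show ?thesis using b by (auto simp: tmax_def le_divide_eq)
  qed

  define M where "M = (j + L * D)\<^sup>2 / 2 + L * r"
  have "0 \<le> D" using d_le norm_ge_zero order_trans by blast
  then have "0 < j + L * D" using j(1) L by (intro add_pos_nonneg mult_nonneg_nonneg)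
  then have "0 < M"
    unfolding M_def using r(1) L by (intro add_pos_nonneg) auto
  \<comment> \<open>Chosen so that the step condition of \<open>armijo_of_small_step\<close> reads
    \<open>s \<le> \<kappa> * \<mu> k\<close>.\<close>
  define \<kappa> where "\<kappa> = (1 - c) * (1 - b) / (M * (1 + b)\<^sup>2 * (h + 1))"
  have den: "0 < M * (1 + b)\<^sup>2 * (h + 1)" using \<open>0 < M\<close> b h by simp
  then have kappa: "0 < \<kappa>"
    unfolding \<kappa>_def using b c by (intro divide_pos_pos[OF _ den] mult_pos_pos) auto
  have kappa_den: "\<kappa> * (M * (1 + b)\<^sup>2 * (h + 1)) = (1 - c) * (1 - b)"
    unfolding \<kappa>_def using less_imp_neq[OF den] by (intro nonzero_eq_divide_eq[THEN iffD1]) auto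
  have small_step: "armijo R c (x k) (d k) s" if "0 \<le> s" "s \<le> 1" "s \<le> \<kappa> * \<mu> k" for k s
  proof (rule armijo_of_small_step[OF diff jac_lipschitz[rule_format] L j(2) r(2) d_le mu_1
        spectral_norm_nonneg h(2)[folded H_def] b(2) c(2) direction(1) direction(2) M_def that(1,2)])
    have "s * (M * (1 + b)\<^sup>2 * (h + 1)) \<le> \<kappa> * \<mu> k * (M * (1 + b)\<^sup>2 * (h + 1))"
      using that(3) den by (intro mult_right_mono) auto
    also have "\<dots> = (1 - c) * (1 - b) * \<mu> k"
      by (simp only: flip: kappa_den) (simp only: mult_ac)
    finally show "s * (M * (1 + b)\<^sup>2 * (h + 1)) \<le> (1 - c) * (1 - b) * \<mu> k" .
  qed
  have tmax_le: "tmax k \<le> 1" for k by (simp add: tmax_def)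

  \<comment> \<open>The entry \<open>1 / 2\<close> keeps \<tau> below every \<open>tmax k\<close>,
    the entry \<kappa> makes it acceptable because \<open>1 \<le> \<mu> k\<close>. Maximality of
    \<open>t k\<close> does the rest.\<close>
  define \<tau> where "\<tau> = min (1 / 2) \<kappa>"
  have tau: "0 < \<tau>" using kappa by (simp add: \<tau>_def)
  have t_ge: "\<tau> \<le> t k" for k
  proof (rule t_max[OF tau])
    show "\<tau> \<le> tmax k" using tmax_ge[of k] by (simp add: \<tau>_def)
    have "\<kappa> * 1 \<le> \<kappa> * \<mu> k" using kappa mu_1 by (intro mult_left_mono) auto
    then show "armijo R c (x k) (d k) \<tau>"
      using tau by (intro small_step) (auto simp: \<tau>_def min_le_iff_disj)
  qed

  \<comment> \<open>Solves \<open>\<Lambda> * (e / j) = 1 / \<kappa>\<close>: from this value of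
    \<open>ell k\<close> on, \<open>\<kappa> * \<mu> k\<close> reaches 1 and thus exceeds or equals
    \<open>tmax k\<close>.\<close>
  define \<Lambda> where "\<Lambda> = j / (\<kappa> * e)"
  have Lambda: "0 < \<Lambda>" using j e kappa by (simp add: \<Lambda>_def)
  have full_step: "\<not> t k < tmax k" if k: "K \<le> k" and "\<Lambda> \<le> ell k" for k
  proof -
    have "\<Lambda> * (e / j) \<le> ell k * norm (R (x k))"
      using that(2) R_ge[OF k] Lambda e j by (intro mult_mono) auto
    then have "1 / \<kappa> \<le> \<mu> k" using mu_ge[of k] j(1) e(1) by (simp add: \<Lambda>_def)
    then have "1 \<le> \<kappa> * \<mu> k" using kappa by (simp add: divide_le_eq mult.commute)
    then have "armijo R c (x k) (d k) (tmax k)"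
      using tmax_ge[of k] tmax_le[of k] by (intro small_step) auto
    then show ?thesis using t_max[of "tmax k" k] tmax_ge[of k] by simp
  qed

  \<comment> \<open>\<open>ell K\<close> starts the induction, \<open>2 * \<Lambda>\<close> covers a
    doubling from below \<Lambda>, and \<open>l_min\<close> covers the floor of the halving
    rule.\<close>
  define lm where "lm = max (ell K) (max l_min (2 * \<Lambda>))"
  have ell_le: "ell k \<le> lm" if "K \<le> k" for k
    using that
  proof (induction k rule: dec_induct)
    case base
    show ?case by (simp add: lm_def)
  next
    case (step k)
    show ?case
    proof (cases "\<Lambda> \<le> ell k")
      case True
      have "ell (Suc k) \<le> max l_min (ell k)"
        unfolding ell_Suc using ell_pos[of k] full_step[OF step(1) True]
        by (intro next_ell_le_full_step) auto
      also have "\<dots> \<le> lm" using step.IH by (simp add: lm_def)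
      finally show ?thesis .
    next
      case False
      have "ell (Suc k) \<le> max l_min (2 * ell k)"
        unfolding ell_Suc using ell_pos[of k] by (intro next_ell_le_double) auto
      also have "\<dots> \<le> lm" using False by (auto simp: lm_def)
      finally show ?thesis .
    qed
  qed
  obtain m where m: "\<And>k. K \<le> k \<Longrightarrow> \<mu> k \<le> m"
    using lms_mu_bounded_above[OF b(2), of lm P R h j r] ell_le ell_pos h(2) j(2) r(2)
    unfolding \<mu>_def by (metis less_imp_le)
  have "0 < m" using m[of K] mu_pos[of K] by simp

  \<comment> \<open>The Armijo decrease with its worst values: step \<tau>, gradient norm
    \<open>e\<close>, denominator \<open>h + m\<close>.\<close>
  define \<delta> where "\<delta> = c * \<tau> * ((1 - b) * e\<^sup>2 / (h + m))"
  have delta: "0 < \<delta>"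
    unfolding \<delta>_def using c b tau e h \<open>0 < m\<close> by (intro mult_pos_pos divide_pos_pos) auto
  have decrease: "objective R (x (Suc k)) \<le> objective R (x k) - \<delta>" if k: "K \<le> k" for k
  proof -
    have "(1 - b) * e\<^sup>2 / (h + m) \<le>
        (1 - b) * (norm (grad R (x k)))\<^sup>2 / (spectral_norm (H k) + \<mu> k)"
      using e(1) e(2)[OF k] b h(2)[of k, folded H_def] m[OF k] mu_pos[of k]
        spectral_norm_nonneg[of "H k"]
      by (intro frac_le mult_left_mono power_mono) auto
    also have "\<dots> \<le> - (d k \<bullet> grad R (x k))"
      using direction(2)[of k] by (simp only: le_minus_iff minus_divide_left mult_minus_left)
    finally have "\<delta> \<le> c * t k * - (d k \<bullet> grad R (x k))"
      unfolding \<delta>_def using c tau t_ge[of k] e b h \<open>0 < m\<close> by (intro mult_mono) auto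
    then show ?thesis using t_armijo[of k] by (simp add: armijo_def x_Suc)
  qed
  have telescoped: "objective R (x (K + n)) \<le> objective R (x K) - n * \<delta>" for n
  proof (induction n)
    case (Suc n)
    then show ?case using decrease[of "K + n"] by (simp add: algebra_simps)
  qed simp
  obtain n where "objective R (x K) < real n * \<delta>"
    using reals_Archimedean3[OF delta] by blast
  then have "objective R (x (K + n)) < 0" using telescoped[of n] by simp
  then show False by (simp add: objective_def mult_less_0_iff)
qed

end
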